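(* The running time of the algorithm IsHalfTwist on an input $(w,k)$, where $w$ is a non-empty braid word in $B_n$ ($n\ge 2$) in normal form, $k=\deg(w)\ge 1$ and $l$ is the length of $w$, is bounded by $O(n^2\cdot\log(n)\cdot k^2\cdot l^3)$.
   Context: $B_n$ is Artin's braid group, generated by $\sigma_1,\dots,\sigma_{n-1}$ with relations $\sigma_i\sigma_j=\sigma_j\sigma_i$ for $|i-j|\ge 2$ and $\sigma_i\sigma_{i+1}\sigma_i=\sigma_{i+1}\sigma_i\sigma_{i+1}$ for $1\le i\le n-2$. A braid word is a finite sequence $\sigma_{i_1}^{e_1}\cdots\sigma_{i_l}^{e_l}$ with $e_j\in\{1,-1\}$; its length is $l$ and its degree is $\deg(w)=e_1+\dots+e_l$. Letters are numbered $1,\dots,l$; $w_{i,j}$ denotes the part of $w$ from the $i$-th to the $j$-th letter, and it is the empty word if $j<i$. A positive braid word is one with all $e_j=1$. A braid word is in normal form if it is $\Delta_n^{-r}w'$, where $\Delta_n=(\sigma_1\cdots\sigma_{n-1})(\sigma_1\cdots\sigma_{n-2})\cdots(\sigma_1\sigma_2)\sigma_1$, $r\ge 0$ is minimal and $w'$ is a positive braid word which is lexicographically smallest among the positive words representing the same element (so the word consists of negative letters followed by positive letters). Subroutines and their costs. For positive braid words $u,v$: WordExtractLeft$(u,v)$ returns false if there is no positive word $v''$ such that $u$ and $vv''$ represent the same element; otherwise it rewrites $u$ as a positive word $vv''$ of the same length representing the same element. WordExtractRight$(u,v)$ is the same with $v''v$ in place of $vv''$. If $u$ has length $l_1$ and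 $v$ has length $l_2$, either subroutine takes time $O(l_2\cdot l_1^2)$ (and $O(1)$ when one of the words is empty). Testing whether a braid word of length at most $l$ represents the identity of $B_n$ is done by a known word-problem algorithm in time $O(n\log(n)\,l^2)$. Elementary manipulations of words of length at most $l$ (taking subwords, concatenating, inverting) take time $O(l)$. Algorithm IsHalfTwist$(w,k)$. Let $iPos$ be the position of the first positive letter of $w$ and $l$ the length of $w$. For $i=1,\dots,n-1$, for $t=0,\dots,k$, for $p=iPos-1,\dots,l$ do the following. (1) Apply WordExtractRight$(w_{iPos,p},\sigma_i^t)$; if it returns false, continue with the next $p$; otherwise replace $w_{iPos,p}$ inside $w$ by the rewritten word ending in $\sigma_i^t$. (2) Apply WordExtractLeft$(w_{p+1,l},\sigma_i^{k-t})$; if it returns false, continue with the next $p$; otherwise replace $w_{p+1,l}$ inside $w$ by the rewritten word beginning with $\sigma_i^{k-t}$. (3) Put $Test=w_{1,p-t}\,w_{p+k-t+1,l}$ and $q=(w_{p+k-t+1,l})^{-1}$. If $Test$ represents the identity of $B_n$, return true together with $q$ and $\sigma_i$. If the loops end without returning, return false. *)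

theory Defs
  imports Complex_Main "HOL-Library.Landau_Symbols" "HOL-Library.Monad_Syntax"
begin

section \<open>Braid words and the braid group\<close>

(* The pair (i, e) stands for the letter sigma_i^e. *)
type_synonym letter = "nat \<times> int"
type_synonym word = "letter list"

definition letter_of :: "nat \<Rightarrow> letter \<Rightarrow> bool" where
  "letter_of n x \<longleftrightarrow> 1 \<le> fst x \<and> fst x \<le> n - 1 \<and> snd x \<in> {1, -1}"

definition braid_word :: "nat \<Rightarrow> word \<Rightarrow> bool" where
  "braid_word n w \<longleftrightarrow> (\<forall>x\<in>set w. letter_of n x)"

definition positive_word :: "nat \<Rightarrow> word \<Rightarrow> bool" where
  "positive_word n w \<longleftrightarrow> braid_word n w \<and> (\<forall>x\<in>set w. snd x = 1)"

definition deg :: "word \<Rightarrow> int" where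
  "deg w = (\<Sum>x\<leftarrow>w. snd x)"

abbreviation inv_letter :: "letter \<Rightarrow> letter" where
  "inv_letter x \<equiv> (fst x, - snd x)"

definition inv_word :: "word \<Rightarrow> word" where
  "inv_word w = rev (map inv_letter w)"

definition sigma :: "nat \<Rightarrow> word" where
  "sigma i = [(i, 1)]"

definition sigma_pow :: "nat \<Rightarrow> nat \<Rightarrow> word" where
  "sigma_pow i t = replicate t (i, 1)"

inductive braid_relation :: "nat \<Rightarrow> word \<Rightarrow> word \<Rightarrow> bool" for n where
  cancel: "letter_of n x \<Longrightarrow> braid_relation n [x, inv_letter x] []"
| far: "\<lbrakk>1 \<le> i; i \<le> n - 1; 1 \<le> j; j \<le> n - 1; \<bar>int i - int j\<bar> \<ge> 2\<rbrakk> \<Longrightarrow>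
    braid_relation n (sigma i @ sigma j) (sigma j @ sigma i)"
| braid: "\<lbrakk>1 \<le> i; i \<le> n - 2\<rbrakk> \<Longrightarrow>
    braid_relation n (sigma i @ sigma (i + 1) @ sigma i)
                     (sigma (i + 1) @ sigma i @ sigma (i + 1))"

(* braid_eq n u v: u and v represent the same element of the group B_n given by Artin's
   presentation, i.e. they are related by the congruence generated by the relations. *)
inductive braid_eq :: "nat \<Rightarrow> word \<Rightarrow> word \<Rightarrow> bool" for n where
  rel: "braid_relation n x y \<Longrightarrow> braid_eq n (a @ x @ b) (a @ y @ b)"
| refl: "braid_eq n u u"
| sym: "braid_eq n u v \<Longrightarrow> braid_eq n v u"
| trans: "braid_eq n u v \<Longrightarrow> braid_eq n v w \<Longrightarrow> braid_eq n u w"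

definition Delta :: "nat \<Rightarrow> word" where
  "Delta n = concat (map (\<lambda>m. concat (map sigma [1..<m + 1])) (rev [1..<n]))"

definition Delta_inv_pow :: "nat \<Rightarrow> nat \<Rightarrow> word" where
  "Delta_inv_pow n r = concat (replicate r (inv_word (Delta n)))"

(* Positive words are compared through their sequences of generator indices. *)
definition lex_le :: "word \<Rightarrow> word \<Rightarrow> bool" where
  "lex_le u v \<longleftrightarrow> u = v \<or> (map fst u, map fst v) \<in> lexord less_than"

definition normal_form :: "nat \<Rightarrow> word \<Rightarrow> bool" where
  "normal_form n w \<longleftrightarrow> (\<exists>r w'. w = Delta_inv_pow n r @ w' \<and> positive_word n w' \<and>
     (\<forall>s v. positive_word n v \<and> braid_eq n w (Delta_inv_pow n s @ v) \<longrightarrow> r \<le> s) \<and>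
     (\<forall>v. positive_word n v \<and> braid_eq n w' v \<longrightarrow> lex_le w' v))"

(* w_{i,j}; letters are numbered from 1. *)
definition subword :: "word \<Rightarrow> nat \<Rightarrow> nat \<Rightarrow> word" where
  "subword w i j = drop (i - 1) (take j w)"

definition first_pos :: "word \<Rightarrow> nat" where
  "first_pos w = length (takeWhile (\<lambda>x. snd x \<noteq> 1) w) + 1"


section \<open>Computations with running time\<close>

(* A computation is its result together with the number of time units it takes. *)
type_synonym 'a timed = "'a \<times> nat"

abbreviation val :: "'a timed \<Rightarrow> 'a" where "val \<equiv> fst"
abbreviation time :: "'a timed \<Rightarrow> nat" where "time \<equiv> snd"

definition bind_timed :: "'a timed \<Rightarrow> ('a \<Rightarrow> 'b timed) \<Rightarrow> 'b timed" where
  "bind_timed m f = (val (f (val m)), time m + time (f (val m)))"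

adhoc_overloading Monad_Syntax.bind \<rightleftharpoons> bind_timed

definition return :: "'a \<Rightarrow> 'a timed" where
  "return x = (x, 1)"

definition tick :: "unit timed" where
  "tick = ((), 1)"

(* Runs the body for the successive values of the loop variable, threading the program
   state 's, and stops as soon as the body returns an answer. *)
fun for_loop :: "'i list \<Rightarrow> ('i \<Rightarrow> 's \<Rightarrow> ('r option \<times> 's) timed) \<Rightarrow> 's \<Rightarrow> ('r option \<times> 's) timed" where
  "for_loop [] body s = return (None, s)"
| "for_loop (i # is) body s = do {
     tick;
     (res, s') \<leftarrow> body i s;
     case res of
       Some r \<Rightarrow> return (Some r, s')
     | None \<Rightarrow> for_loop is body s'
   }"


section \<open>The subroutines\<close>

(* The extraction procedures return None for "false". The group B_n is an explicit
   parameter of the procedures, so that time bounds can be uniform in n. The fields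
   named cost give the times of the elementary manipulations of words. *)
record subroutines =
  extract_left :: "nat \<Rightarrow> word \<Rightarrow> word \<Rightarrow> word option timed"
  extract_right :: "nat \<Rightarrow> word \<Rightarrow> word \<Rightarrow> word option timed"
  trivial_test :: "nat \<Rightarrow> word \<Rightarrow> bool timed"
  length_cost :: "word \<Rightarrow> nat"
  first_pos_cost :: "word \<Rightarrow> nat"
  subword_cost :: "word \<Rightarrow> nat \<Rightarrow> nat \<Rightarrow> nat"
  append_cost :: "word \<Rightarrow> word \<Rightarrow> nat"
  inverse_cost :: "word \<Rightarrow> nat"
  power_cost :: "nat \<Rightarrow> nat \<Rightarrow> nat"

definition extract_left_correct :: "(nat \<Rightarrow> word \<Rightarrow> word \<Rightarrow> word option timed) \<Rightarrow> bool" where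
  "extract_left_correct f \<longleftrightarrow>
     (\<forall>n u v. n \<ge> 2 \<and> positive_word n u \<and> positive_word n v \<longrightarrow>
        (case val (f n u v) of
           None \<Rightarrow> \<not> (\<exists>v''. positive_word n v'' \<and> braid_eq n u (v @ v''))
         | Some u' \<Rightarrow> (\<exists>v''. positive_word n v'' \<and> u' = v @ v'' \<and>
                          length u' = length u \<and> braid_eq n u u')))"

definition extract_right_correct :: "(nat \<Rightarrow> word \<Rightarrow> word \<Rightarrow> word option timed) \<Rightarrow> bool" where
  "extract_right_correct f \<longleftrightarrow>
     (\<forall>n u v. n \<ge> 2 \<and> positive_word n u \<and> positive_word n v \<longrightarrow>
        (case val (f n u v) of
           None \<Rightarrow> \<not> (\<exists>v''. positive_word n v'' \<and> braid_eq n u (v'' @ v))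
         | Some u' \<Rightarrow> (\<exists>v''. positive_word n v'' \<and> u' = v'' @ v \<and>
                          length u' = length u \<and> braid_eq n u u')))"

definition trivial_test_correct :: "(nat \<Rightarrow> word \<Rightarrow> bool timed) \<Rightarrow> bool" where
  "trivial_test_correct f \<longleftrightarrow>
     (\<forall>n w. n \<ge> 2 \<and> braid_word n w \<longrightarrow> val (f n w) = braid_eq n w [])"

(* Over the filter principal S, membership in O means that one constant serves for all
   elements of S; this is how the O-bounds in several variables are expressed below. *)

definition extract_time_bound :: "(nat \<Rightarrow> word \<Rightarrow> word \<Rightarrow> word option timed) \<Rightarrow> bool" where
  "extract_time_bound f \<longleftrightarrow>
     (\<lambda>(n, u, v). real (time (f n u v)))
       \<in> O[principal {(n, u, v). n \<ge> 2 \<and> positive_word n u \<and> positive_word n v \<and>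
                                u \<noteq> [] \<and> v \<noteq> []}](
          \<lambda>(n, u, v). real (length v) * real (length u) ^ 2) \<and>
     (\<lambda>(n, u, v). real (time (f n u v)))
       \<in> O[principal {(n, u, v). n \<ge> 2 \<and> positive_word n u \<and> positive_word n v \<and>
                                (u = [] \<or> v = [])}](\<lambda>_. 1)"

definition trivial_test_time_bound :: "(nat \<Rightarrow> word \<Rightarrow> bool timed) \<Rightarrow> bool" where
  "trivial_test_time_bound f \<longleftrightarrow>
     (\<lambda>(n, l, w). real (time (f n w)))
       \<in> O[principal {(n, l, w). n \<ge> 2 \<and> l \<ge> 1 \<and> braid_word n w \<and> length w \<le> l}](
          \<lambda>(n, l, w). real n * ln (real n) * real l ^ 2)"

(* The bound l on the lengths is at least 1, since manipulating an empty word may well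
   take a positive amount of time. *)
definition manipulation_time_bounds :: "subroutines \<Rightarrow> bool" where
  "manipulation_time_bounds S \<longleftrightarrow>
     (\<lambda>(l, w). real (length_cost S w))
       \<in> O[principal {(l, w). l \<ge> 1 \<and> length w \<le> l}](
          \<lambda>(l, w). real l) \<and>
     (\<lambda>(l, w). real (first_pos_cost S w))
       \<in> O[principal {(l, w). l \<ge> 1 \<and> length w \<le> l}](
          \<lambda>(l, w). real l) \<and>
     (\<lambda>(l, w, i, j). real (subword_cost S w i j))
       \<in> O[principal {(l, w, i, j). l \<ge> 1 \<and> length w \<le> l}](
          \<lambda>(l, w, i, j). real l) \<and>
     (\<lambda>(l, u, v). real (append_cost S u v))
       \<in> O[principal {(l, u, v). l \<ge> 1 \<and> length u \<le> l \<and> length v \<le> l}](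
          \<lambda>(l, u, v). real l) \<and>
     (\<lambda>(l, w). real (inverse_cost S w))
       \<in> O[principal {(l, w). l \<ge> 1 \<and> length w \<le> l}](
          \<lambda>(l, w). real l) \<and>
     (\<lambda>(l, i, t). real (power_cost S i t))
       \<in> O[principal {(l, i, t). l \<ge> 1 \<and> t \<le> l}](
          \<lambda>(l, i, t). real l)"


section \<open>The algorithm IsHalfTwist\<close>

definition length_t :: "subroutines \<Rightarrow> word \<Rightarrow> nat timed" where
  "length_t S w = (length w, length_cost S w)"

definition first_pos_t :: "subroutines \<Rightarrow> word \<Rightarrow> nat timed" where
  "first_pos_t S w = (first_pos w, first_pos_cost S w)"

definition subword_t :: "subroutines \<Rightarrow> word \<Rightarrow> nat \<Rightarrow> nat \<Rightarrow> word timed" where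
  "subword_t S w i j = (subword w i j, subword_cost S w i j)"

definition append_t :: "subroutines \<Rightarrow> word \<Rightarrow> word \<Rightarrow> word timed" where
  "append_t S u v = (u @ v, append_cost S u v)"

definition inverse_t :: "subroutines \<Rightarrow> word \<Rightarrow> word timed" where
  "inverse_t S w = (inv_word w, inverse_cost S w)"

definition power_t :: "subroutines \<Rightarrow> nat \<Rightarrow> nat \<Rightarrow> word timed" where
  "power_t S i t = (sigma_pow i t, power_cost S i t)"

(* One pass through steps (1)-(3). The word w is a program variable that keeps the
   replacements made in (1) and (2), also when the pass is abandoned afterwards. An answer
   (q, x) means "return true together with q and x". *)
definition half_twist_step ::
  "subroutines \<Rightarrow> nat \<Rightarrow> nat \<Rightarrow> nat \<Rightarrow> nat \<Rightarrow> nat \<Rightarrow> nat \<Rightarrow> nat \<Rightarrow> word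
     \<Rightarrow> ((word \<times> word) option \<times> word) timed" where
  "half_twist_step S n k iPos l i t p w = do {
     u \<leftarrow> subword_t S w iPos p;
     x \<leftarrow> power_t S i t;
     right \<leftarrow> extract_right S n u x;
     case right of
       None \<Rightarrow> return (None, w)
     | Some u' \<Rightarrow> do {
         a \<leftarrow> subword_t S w 1 (iPos - 1);
         b \<leftarrow> subword_t S w (p + 1) l;
         au \<leftarrow> append_t S a u';
         w \<leftarrow> append_t S au b;
         v \<leftarrow> subword_t S w (p + 1) l;
         y \<leftarrow> power_t S i (k - t);
         left \<leftarrow> extract_left S n v y;
         case left of
           None \<Rightarrow> return (None, w)
         | Some v' \<Rightarrow> do {
             c \<leftarrow> subword_t S w 1 p;
             w \<leftarrow> append_t S c v';
             d \<leftarrow> subword_t S w 1 (p - t);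
             e \<leftarrow> subword_t S w (p + k - t + 1) l;
             Test \<leftarrow> append_t S d e;
             q \<leftarrow> inverse_t S e;
             trivial \<leftarrow> trivial_test S n Test;
             if trivial then return (Some (q, sigma i), w) else return (None, w)
           }
       }
   }"

(* None stands for the answer "false". *)
definition is_half_twist ::
  "subroutines \<Rightarrow> nat \<Rightarrow> word \<Rightarrow> nat \<Rightarrow> (word \<times> word) option timed" where
  "is_half_twist S n w k = do {
     iPos \<leftarrow> first_pos_t S w;
     l \<leftarrow> length_t S w;
     (res, w) \<leftarrow> for_loop [1..<n] (\<lambda>i.
                   for_loop [0..<k + 1] (\<lambda>t.
                     for_loop [iPos - 1..<l + 1] (\<lambda>p.
                       half_twist_step S n k iPos l i t p))) w;
     return res
   }"

end

theory Submission
  imports Defs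
begin

text \<open>Every pass through steps (1)--(3) costs \<open>O(n log n \<sqdot> k l\<^sup>2)\<close>, since the two extractions
  cost \<open>O(k l\<^sup>2)\<close> and the word problem \<open>O(n log n \<sqdot> l\<^sup>2)\<close>; there are at most
  \<open>n (k + 1) (l + 1)\<close> passes. The cost bounds stay applicable in all passes because the
  replacements preserve the length of the program variable \<open>w\<close> and the positivity of its part
  from \<open>iPos\<close> on.\<close>

section \<open>O-bounds over principal filters\<close>

text \<open>Over a principal filter, one constant must work on all of \<open>A\<close>, and then
  every larger constant works as well. The form "for all sufficiently large \<open>c\<close>" allows
  several O-hypotheses to be merged into one common constant.\<close>

lemma bigo_principal_iff_eventually:
  fixes f g :: "'a \<Rightarrow> real"
  shows "f \<in> O[principal A](g) \<longleftrightarrow> (\<forall>\<^sub>F c in at_top. \<forall>x\<in>A. \<bar>f x\<bar> \<le> c * \<bar>g x\<bar>)"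
proof
  assume "f \<in> O[principal A](g)"
  then obtain c where c: "\<forall>x\<in>A. \<bar>f x\<bar> \<le> c * \<bar>g x\<bar>"
    by (auto elim!: landau_o.bigE simp: eventually_principal)
  have "\<forall>x\<in>A. \<bar>f x\<bar> \<le> d * \<bar>g x\<bar>" if "d \<ge> c" for d
    using c that by (meson abs_ge_zero mult_right_mono order_trans)
  then show "\<forall>\<^sub>F c in at_top. \<forall>x\<in>A. \<bar>f x\<bar> \<le> c * \<bar>g x\<bar>"
    by (auto simp: eventually_at_top_linorder)
next
  assume "\<forall>\<^sub>F c in at_top. \<forall>x\<in>A. \<bar>f x\<bar> \<le> c * \<bar>g x\<bar>"
  then obtain c where "\<forall>x\<in>A. \<bar>f x\<bar> \<le> c * \<bar>g x\<bar>"
    using eventually_happens' trivial_limit_at_top_linorder by blast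
  then show "f \<in> O[principal A](g)"
    by (intro bigoI[of _ c]) (auto simp: eventually_principal)
qed

section \<open>Closure properties of braid words and positive words\<close>

lemma braid_word_append [simp]: "braid_word n (u @ v) \<longleftrightarrow> braid_word n u \<and> braid_word n v"
  by (auto simp: braid_word_def)

lemma positive_word_append [simp]:
  "positive_word n (u @ v) \<longleftrightarrow> positive_word n u \<and> positive_word n v"
  by (auto simp: positive_word_def)

lemma braid_word_take: "braid_word n w \<Longrightarrow> braid_word n (take m w)"
  by (auto simp: braid_word_def dest: in_set_takeD)

lemma braid_word_drop: "braid_word n w \<Longrightarrow> braid_word n (drop m w)"
  by (auto simp: braid_word_def dest: in_set_dropD)

lemma positive_word_take: "positive_word n w \<Longrightarrow> positive_word n (take m w)"
  by (auto simp: positive_word_def braid_word_take dest: in_set_takeD)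

lemma positive_word_drop: "positive_word n w \<Longrightarrow> positive_word n (drop m w)"
  by (auto simp: positive_word_def braid_word_drop dest: in_set_dropD)

lemma positive_imp_braid_word: "positive_word n w \<Longrightarrow> braid_word n w"
  by (simp add: positive_word_def)

lemma positive_word_sigma_pow: "1 \<le> i \<Longrightarrow> i < n \<Longrightarrow> positive_word n (sigma_pow i t)"
  by (auto simp: positive_word_def braid_word_def letter_of_def sigma_pow_def)

lemma length_sigma_pow [simp]: "length (sigma_pow i t) = t"
  by (simp add: sigma_pow_def)

lemma length_subword_le: "length (subword w i j) \<le> length w"
  by (simp add: subword_def)

lemma braid_word_subword: "braid_word n w \<Longrightarrow> braid_word n (subword w i j)"
  by (simp add: subword_def braid_word_take braid_word_drop)

text \<open>The rewritten word is a product of two positive words, hence positive. Positivity and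
  equal length are what the loop invariant takes from the correctness of the extractions.\<close>

lemma extract_left_SomeD:
  assumes "extract_left_correct f" "n \<ge> 2" "positive_word n u" "positive_word n v"
    and "val (f n u v) = Some u'"
  shows "positive_word n u'" "length u' = length u"
  using assms unfolding extract_left_correct_def by fastforce+

lemma extract_right_SomeD:
  assumes "extract_right_correct f" "n \<ge> 2" "positive_word n u" "positive_word n v"
    and "val (f n u v) = Some u'"
  shows "positive_word n u'" "length u' = length u"
  using assms unfolding extract_right_correct_def by fastforce+

section \<open>Running time of loops\<close>

text \<open>An iteration costs one \<open>tick\<close> and at most \<open>B\<close>, and leaving the
  loop costs one more unit, whether by exhaustion or by an answer; \<open>B + 2\<close> is a
  generous share per iteration. The invariant also covers the state after an early answer, so that a
  loop can itself be the body of an outer loop.\<close>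

lemma for_loop_invariant_time:
  fixes body :: "'i \<Rightarrow> 's \<Rightarrow> ('r option \<times> 's) timed" and B :: real
  assumes "\<And>i s. i \<in> set is \<Longrightarrow> I s \<Longrightarrow> I (snd (val (body i s))) \<and> real (time (body i s)) \<le> B"
    and "B \<ge> 0" and "I s"
  shows "I (snd (val (for_loop is body s))) \<and>
    real (time (for_loop is body s)) \<le> real (length is) * (B + 2) + 1"
  using assms(1,3)
proof (induction "is" arbitrary: s)
  case Nil
  then show ?case by (simp add: return_def)
next
  case (Cons i "is")
  have step: "I (snd (val (body i s)))" "real (time (body i s)) \<le> B"
    using Cons.prems by auto
  have IH: "I (snd (val (for_loop is body (snd (val (body i s)))))) \<and>
      real (time (for_loop is body (snd (val (body i s))))) \<le> real (length is) * (B + 2) + 1"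
    using Cons.prems step by (intro Cons.IH) auto
  have "0 \<le> real (length is) * (B + 2)"
    using \<open>B \<ge> 0\<close> by simp
  then show ?case
    using step IH
    by (auto simp: bind_timed_def return_def tick_def case_prod_beta algebra_simps
        split: option.splits)
qed

text \<open>A purely multiplicative form, suited to nesting. As \<open>B\<close> and
  \<open>m\<close> are at least 1, \<open>2 * m * (B + 2) + 1\<close> is at most
  \<open>(2 + 4 + 1) * m * B\<close>. The allowance \<open>2 * m\<close> accommodates loops with
  \<open>k + 1\<close> or \<open>l + 1\<close> iterations.\<close>

lemma for_loop_invariant_time_mult:
  fixes body :: "'i \<Rightarrow> 's \<Rightarrow> ('r option \<times> 's) timed" and B m :: real
  assumes "\<And>i s. i \<in> set is \<Longrightarrow> I s \<Longrightarrow> I (snd (val (body i s))) \<and> real (time (body i s)) \<le> B"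
    and "B \<ge> 1" and "I s" and "real (length is) \<le> 2 * m" and "m \<ge> 1"
  shows "I (snd (val (for_loop is body s))) \<and> real (time (for_loop is body s)) \<le> 7 * m * B"
proof -
  have "real (length is) * (B + 2) \<le> 2 * m * (B + 2)"
    using assms by (intro mult_right_mono) auto
  moreover have "m * 1 \<le> m * B"
    using assms by (intro mult_left_mono) auto
  moreover have "2 * m * (B + 2) = 2 * (m * B) + 4 * m" "7 * m * B = 7 * (m * B)"
    by (simp_all add: algebra_simps)
  ultimately have "real (length is) * (B + 2) + 1 \<le> 7 * m * B"
    using \<open>m \<ge> 1\<close> by linarith
  then show ?thesis
    using for_loop_invariant_time[of "is" I body B s] assms by force
qed

section \<open>The cost hypotheses with one explicit constant\<close>

text \<open>A single \<open>C\<close> replaces the constants of all O-hypotheses. The summand 1 in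
  the extraction bounds accounts for empty words, and \<open>C \<ge> 1\<close> lets unit costs be
  absorbed.\<close>

locale bounded_subroutines =
  fixes S :: subroutines and C :: real
  assumes C_ge_1: "C \<ge> 1"
    and left_correct: "extract_left_correct (extract_left S)"
    and right_correct: "extract_right_correct (extract_right S)"
    and left_time: "\<And>n u v. n \<ge> 2 \<Longrightarrow> positive_word n u \<Longrightarrow> positive_word n v \<Longrightarrow>
      real (time (extract_left S n u v)) \<le> C * (1 + real (length v) * real (length u) ^ 2)"
    and right_time: "\<And>n u v. n \<ge> 2 \<Longrightarrow> positive_word n u \<Longrightarrow> positive_word n v \<Longrightarrow>
      real (time (extract_right S n u v)) \<le> C * (1 + real (length v) * real (length u) ^ 2)"
    and test_time: "\<And>n l w. n \<ge> 2 \<Longrightarrow> l \<ge> 1 \<Longrightarrow> braid_word n w \<Longrightarrow> length w \<le> l \<Longrightarrow>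
      real (time (trivial_test S n w)) \<le> C * (real n * ln (real n) * real l ^ 2)"
    and length_time: "\<And>l w. l \<ge> 1 \<Longrightarrow> length w \<le> l \<Longrightarrow> real (length_cost S w) \<le> C * real l"
    and first_pos_time: "\<And>l w. l \<ge> 1 \<Longrightarrow> length w \<le> l \<Longrightarrow> real (first_pos_cost S w) \<le> C * real l"
    and subword_time: "\<And>l w i j. l \<ge> 1 \<Longrightarrow> length w \<le> l \<Longrightarrow> real (subword_cost S w i j) \<le> C * real l"
    and append_time: "\<And>l u v. l \<ge> 1 \<Longrightarrow> length u \<le> l \<Longrightarrow> length v \<le> l \<Longrightarrow>
      real (append_cost S u v) \<le> C * real l"
    and inverse_time: "\<And>l w. l \<ge> 1 \<Longrightarrow> length w \<le> l \<Longrightarrow> real (inverse_cost S w) \<le> C * real l"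
    and power_time: "\<And>l i t. l \<ge> 1 \<Longrightarrow> t \<le> l \<Longrightarrow> real (power_cost S i t) \<le> C * real l"

text \<open>Each hypothesis holds for all sufficiently large constants, so finitely many of them
  hold for a common one.\<close>

lemma bounded_subroutines_exists:
  assumes "extract_left_correct (extract_left S)"
    and "extract_right_correct (extract_right S)"
    and "extract_time_bound (extract_left S)"
    and "extract_time_bound (extract_right S)"
    and "trivial_test_time_bound (trivial_test S)"
    and "manipulation_time_bounds S"
  obtains C where "bounded_subroutines S C"
proof -
  have extraction: "\<forall>\<^sub>F c in at_top. \<forall>n u v. n \<ge> 2 \<longrightarrow> positive_word n u \<longrightarrow> positive_word n v \<longrightarrow>
      real (time (f n u v)) \<le> c * (1 + real (length v) * real (length u) ^ 2)"
    if "extract_time_bound f" for f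
    using that[unfolded extract_time_bound_def bigo_principal_iff_eventually, THEN conjunct1]
      that[unfolded extract_time_bound_def bigo_principal_iff_eventually, THEN conjunct2]
      eventually_ge_at_top[of "0::real"]
  proof eventually_elim
    case (elim c)
    show ?case
    proof (intro allI impI)
      fix n u v
      assume *: "n \<ge> 2" "positive_word n u" "positive_word n v"
      show "real (time (f n u v)) \<le> c * (1 + real (length v) * real (length u) ^ 2)"
      \<comment> \<open>For an empty word the product of lengths vanishes and the O(1) bound
        remains; otherwise the summand 1 is slack.\<close>
      proof (cases "u = [] \<or> v = []")
        case True
        then show ?thesis using elim(2) * by fastforce
      next
        case False
        then have "real (time (f n u v)) \<le> c * (real (length v) * real (length u) ^ 2)"
          using elim(1) * by fastforce
        then show ?thesis using elim(3) by (simp add: algebra_simps)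
      qed
    qed
  qed
  have "\<forall>\<^sub>F C in at_top. bounded_subroutines S C"
    using extraction[OF assms(3)] extraction[OF assms(4)] eventually_ge_at_top[of "1::real"]
      assms(5)[unfolded trivial_test_time_bound_def bigo_principal_iff_eventually]
      \<comment> \<open>The six manipulation bounds are merged into one eventual statement, to be
        eliminated together with the others.\<close>
      assms(6)[unfolded manipulation_time_bounds_def bigo_principal_iff_eventually
        eventually_conj_iff[symmetric]]
  proof eventually_elim
    case (elim C)
    \<comment> \<open>The absolute value in the O-bound disappears because
      \<open>ln (real n)\<close> is nonnegative for \<open>n \<ge> 2\<close>.\<close>
    have test: "real (time (trivial_test S n w)) \<le> C * (real n * ln (real n) * real l ^ 2)"
      if "n \<ge> 2" "l \<ge> 1" "braid_word n w" "length w \<le> l" for n l w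
      using elim(4)[THEN bspec, of "(n, l, w)"] that by (simp add: abs_mult)
    show ?case
    proof
    qed (use elim(1-3,5) assms(1,2) test in auto)
  qed
  then show thesis
    using that eventually_happens' trivial_limit_at_top_linorder by blast
qed

section \<open>The loop invariant and its preservation\<close>

text \<open>The invariant of the program variable \<open>w\<close>, with \<open>j = iPos - 1\<close>.\<close>

definition half_twist_inv :: "nat \<Rightarrow> nat \<Rightarrow> nat \<Rightarrow> word \<Rightarrow> bool" where
  "half_twist_inv n j l w \<longleftrightarrow> length w = l \<and> braid_word n w \<and> positive_word n (drop j w)"

text \<open>This is the replacement of step (1). The new block has the length of the old one, and
  what follows it is a suffix of the old positive part.\<close>

lemma half_twist_inv_replace:
  assumes "half_twist_inv n j l w" "j \<le> p" "p \<le> l" "positive_word n u"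
    and "length u = p - j"
  shows "half_twist_inv n j l (take j w @ u @ drop p w)"
proof -
  \<comment> \<open>The two drops are kept apart by \<open>del: drop_drop\<close>, so that
    \<open>drop p w\<close> is seen as a suffix of the positive word
    \<open>drop j w\<close>.\<close>
  have "positive_word n (drop (p - j) (drop j w))"
    using assms positive_word_drop by (simp add: half_twist_inv_def del: drop_drop)
  then have "positive_word n (drop p w)"
    using assms by simp
  moreover have "drop j (take j w @ u @ drop p w) = u @ drop p w"
    using assms by (simp add: half_twist_inv_def)
  moreover have "length (take j w @ u @ drop p w) = l"
    using assms by (simp add: half_twist_inv_def)
  ultimately show ?thesis
    using assms unfolding half_twist_inv_def
    by (metis braid_word_append braid_word_take positive_imp_braid_word positive_word_append)
qed

text \<open>This is the replacement of step (2), which affects everything after letter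
  \<open>p\<close>.\<close>

lemma half_twist_inv_replace_end:
  assumes "half_twist_inv n j l w" "j \<le> p" "p \<le> l" "positive_word n v"
    and "length v = l - p"
  shows "half_twist_inv n j l (take p w @ v)"
proof -
  have "positive_word n (drop j (take p w))"
    using assms by (auto simp: half_twist_inv_def drop_take positive_word_take)
  then show ?thesis
    using assms
    by (auto simp: half_twist_inv_def braid_word_take positive_imp_braid_word)
qed

text \<open>The logarithm is at least \<open>ln 2 \<ge> 1/2\<close>, since
  \<open>exp (1/2) \<le> 2\<close>. The bound allows the factor \<open>n ln n\<close> to be inserted
  into costs that do not contain it.\<close>

lemma n_ln_n_ge_1:
  assumes "n \<ge> (2::nat)"
  shows "real n * ln (real n) \<ge> 1"
proof -
  have "ln 2 \<ge> (1/2 :: real)"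
    using ln_ge_iff[of 2 "1/2"] exp_half_le2 by simp
  moreover have "ln 2 \<le> ln (real n)"
    using assms by simp
  ultimately have "1/2 \<le> ln (real n)" by linarith
  then show ?thesis
    using assms mult_mono[of 2 "real n" "1/2" "ln (real n)"] by simp
qed

section \<open>Cost of one pass and of the whole algorithm\<close>

context bounded_subroutines
begin

text \<open>In units of \<open>C * X\<close>, a manipulation costs at most 1, an extraction 2 and
  the word problem 4. The operations up to the left extraction sum to 12, the later ones to 10, and
  the final \<open>return\<close> adds 1.\<close>

lemma half_twist_step_bound:
  fixes X :: real
  assumes n: "n \<ge> 2" and k: "k \<ge> 1" and l: "l \<ge> 1" and i: "1 \<le> i" "i < n" and t: "t \<le> k"
    and p: "j \<le> p" "p \<le> l" and inv: "half_twist_inv n j l w"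
    and X: "X = real n * ln (real n) * real k * real l ^ 2"
  defines "step \<equiv> half_twist_step S n k (j + 1) l i t p w"
  shows "half_twist_inv n j l (snd (val step)) \<and> real (time step) \<le> 23 * C * X"
proof -
  have nl: "real n * ln (real n) \<ge> 1"
    using n by (rule n_ln_n_ge_1)
  have kl2: "real k * real l ^ 2 \<le> X"
    using mult_right_mono[OF nl, of "real k * real l ^ 2"] by (simp add: X mult.assoc)
  have lX: "real l \<le> X" and kX: "real k \<le> X" and X1: "1 \<le> X"
  proof -
    have "real l * 1 \<le> real l * real l" "1 * real l ^ 2 \<le> real k * real l ^ 2"
      "real k * 1 \<le> real k * real l ^ 2"
      using k l by (intro mult_left_mono mult_right_mono; simp add: one_le_power)+
    then have "real l \<le> real k * real l ^ 2" "real k \<le> real k * real l ^ 2"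
      unfolding power2_eq_square by linarith+
    moreover have "1 \<le> real l"
      using l by simp
    ultimately show "real l \<le> X" "real k \<le> X" "1 \<le> X"
      using kl2 by linarith+
  qed
  have C0: "0 \<le> C" using C_ge_1 by simp
  have scale: "x \<le> C * X" if "x \<le> C * y" "y \<le> X" for x y
    using that C0 by (meson mult_left_mono order_trans)
  have cost_extract: "C * (1 + real s * real m ^ 2) \<le> 2 * C * X" if "s \<le> k" "m \<le> l" for s m :: nat
  proof -
    have "real s * real m ^ 2 \<le> real k * real l ^ 2"
      using that by (intro mult_mono power_mono) auto
    then have "C * (1 + real s * real m ^ 2) \<le> C * (X + X)"
      using kl2 X1 C0 by (intro mult_left_mono) auto
    then show ?thesis by simp
  qed
  have sub: "real (subword_cost S v a b) \<le> C * X" if "length v \<le> l" for v a b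
    using scale[OF subword_time[OF l that] lX] .
  have app: "real (append_cost S u v) \<le> C * X" if "length u \<le> l" "length v \<le> l" for u v
    using scale[OF append_time[OF l that] lX] .
  have inver: "real (inverse_cost S v) \<le> C * X" if "length v \<le> l" for v
    using scale[OF inverse_time[OF l that] lX] .
  \<comment> \<open>Here \<open>k\<close> plays the role of the length bound, which is legitimate
    because \<open>k \<ge> 1\<close>.\<close>
  have pow: "real (power_cost S i s) \<le> C * X" if "s \<le> k" for s
    using scale[OF power_time[OF k that] kX] .
  \<comment> \<open>The tested word is a concatenation of two words of length at most
    \<open>l\<close>. The crude bound \<open>2 * l\<close> avoids comparing their positions and
    causes the factor 4.\<close>
  have test: "real (time (trivial_test S n v)) \<le> 4 * C * X"
    if "braid_word n v" "length v \<le> 2 * l" for v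
  proof -
    have "real n * ln (real n) * real l ^ 2 * 1 \<le> real n * ln (real n) * real l ^ 2 * real k"
      using nl k by (intro mult_left_mono) auto
    then have "real n * ln (real n) * real (2 * l) ^ 2 \<le> 4 * X"
      by (simp add: X power_mult_distrib mult_ac)
    moreover have "2 * l \<ge> 1" using l by simp
    ultimately show ?thesis
      using test_time[OF n _ that] mult_left_mono[OF _ C0] by fastforce
  qed
  have CX: "1 \<le> C * X"
    using mult_mono[of 1 C 1 X] C_ge_1 X1 by simp

  define u where "u = subword w (j + 1) p"
  \<comment> \<open>Letters are numbered from 1, so starting at \<open>j + 1\<close> drops
    \<open>j\<close> letters; for \<open>p = j\<close> the word is empty.\<close>
  have u: "u = drop j (take p w)" by (simp add: u_def subword_def)
  have len_w: "length w = l" and pos_w: "positive_word n (drop j w)"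
    using inv by (auto simp: half_twist_inv_def)
  have pos_u: "positive_word n u" and len_u: "length u = p - j"
    using pos_w p len_w by (auto simp: u drop_take positive_word_take)
  have pos_pow: "positive_word n (sigma_pow i s)" for s
    using i by (rule positive_word_sigma_pow)
  have time_right: "real (time (extract_right S n u (sigma_pow i t))) \<le> 2 * C * X"
    using right_time[OF n pos_u pos_pow[of t]] cost_extract[OF t, of "length u"] len_u p
    by fastforce
  note sub1 = sub[of w "j + 1" p, folded u_def] and pow1 = pow[OF t]
  show ?thesis
  proof (cases "val (extract_right S n u (sigma_pow i t))")
    case None
    then have "step = ((None, w), subword_cost S w (j + 1) p + (power_cost S i t +
        (time (extract_right S n u (sigma_pow i t)) + 1)))"
      by (simp add: step_def half_twist_step_def bind_timed_def subword_t_def power_t_def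
          return_def u_def)
    then show ?thesis
      using inv sub1 pow1 time_right len_w CX by simp
  next
    case (Some u')
    note right = Some
    have pos_u': "positive_word n u'" and len_u': "length u' = p - j"
      using extract_right_SomeD[OF right_correct n pos_u pos_pow right] len_u by auto
    \<comment> \<open>The program variable after step (1).\<close>
    define w1 where "w1 = (subword w 1 j @ u') @ subword w (p + 1) l"
    have w1: "w1 = take j w @ u' @ drop p w"
      using len_w by (simp add: w1_def subword_def)
    have inv1: "half_twist_inv n j l w1"
      unfolding w1 using inv p pos_u' len_u' by (rule half_twist_inv_replace)
    then have len_w1: "length w1 = l" and pos_w1: "positive_word n (drop j w1)"
      by (auto simp: half_twist_inv_def)
    define v where "v = subword w1 (p + 1) l"
    have v: "v = drop p w1" using len_w1 by (simp add: v_def subword_def)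
    have "positive_word n (drop (p - j) (drop j w1))"
      using pos_w1 by (rule positive_word_drop)
    then have pos_v: "positive_word n v" and len_v: "length v = l - p"
      using p len_w1 by (auto simp: v)
    have time_left: "real (time (extract_left S n v (sigma_pow i (k - t)))) \<le> 2 * C * X"
      using left_time[OF n pos_v pos_pow[of "k - t"]] cost_extract[of "k - t" "length v"] len_v
      by fastforce
    have len1: "length (subword w 1 j) \<le> j" "length (subword w (p + 1) l) \<le> l - p"
      using len_w by (auto simp: subword_def)
    have app1: "real (append_cost S (subword w 1 j) u') \<le> C * X"
      "real (append_cost S (subword w 1 j @ u') (subword w (p + 1) l)) \<le> C * X"
      using len1 len_u' p by (auto intro!: app)
    note times1 = sub1 pow1 time_right app1 time_left pow[of "k - t"] sub[of w 1 j]
      sub[of w "p + 1" l] sub[of w1 "p + 1" l]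
    \<comment> \<open>The cost up to and including the left extraction, shared by both of its
      outcomes: eight manipulations and two extractions.\<close>
    define T where "T = subword_cost S w (j + 1) p + power_cost S i t
      + time (extract_right S n u (sigma_pow i t)) + subword_cost S w 1 j
      + subword_cost S w (p + 1) l + append_cost S (subword w 1 j) u'
      + append_cost S (subword w 1 j @ u') (subword w (p + 1) l)
      + subword_cost S w1 (p + 1) l + power_cost S i (k - t)
      + time (extract_left S n v (sigma_pow i (k - t)))"
    have T: "real T \<le> 12 * C * X"
      using times1 len_w len_w1 by (simp add: T_def)
    show ?thesis
    proof (cases "val (extract_left S n v (sigma_pow i (k - t)))")
      case None
      then have "step = ((None, w1), T + 1)"
        using right
        by (simp add: step_def half_twist_step_def bind_timed_def subword_t_def power_t_def
            append_t_def return_def T_def u_def v_def w1_def)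
      then show ?thesis
        using inv1 T CX by simp
    next
      case (Some v')
      note left = Some
      have pos_v': "positive_word n v'" and len_v': "length v' = l - p"
        using extract_left_SomeD[OF left_correct n pos_v pos_pow left] len_v by auto
      \<comment> \<open>The program variable after step (2).\<close>
      define w2 where "w2 = subword w1 1 p @ v'"
      have w2: "w2 = take p w1 @ v'"
        by (simp add: w2_def subword_def)
      have inv2: "half_twist_inv n j l w2"
        unfolding w2 using inv1 p pos_v' len_v' by (rule half_twist_inv_replace_end)
      then have len_w2: "length w2 = l" and braid_w2: "braid_word n w2"
        by (auto simp: half_twist_inv_def)
      define d where "d = subword w2 1 (p - t)"
      define e where "e = subword w2 (p + k - t + 1) l"
      have de: "braid_word n d" "braid_word n e" "length d \<le> l" "length e \<le> l"
        using braid_w2 length_subword_le[of w2] len_w2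
        by (auto simp: d_def e_def braid_word_subword)
      have "length (subword w1 1 p) \<le> l" "length v' \<le> l"
        using length_subword_le[of w1] len_w1 len_v' by auto
      note times2 = sub[of w1 1 p] app[OF this] sub[of w2 1 "p - t"] sub[of w2 "p + k - t + 1" l]
        app[OF de(3,4)] inver[OF de(4)] test[of "d @ e"]
      define T' where "T' = subword_cost S w1 1 p + append_cost S (subword w1 1 p) v'
        + subword_cost S w2 1 (p - t) + subword_cost S w2 (p + k - t + 1) l
        + append_cost S d e + inverse_cost S e + time (trivial_test S n (d @ e))"
      have T': "real T' \<le> 10 * C * X"
        using times2 len_w1 len_w2 de by (simp add: T'_def)
      \<comment> \<open>Both outcomes of the test keep \<open>w2\<close> and cost one
        \<open>return\<close>, so no case distinction on the answer is made.\<close>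
      have "snd (val step) = w2 \<and> time step = T + T' + 1"
        using right left
        by (simp add: step_def half_twist_step_def bind_timed_def subword_t_def power_t_def
            append_t_def inverse_t_def return_def T_def T'_def u_def v_def w1_def w2_def d_def e_def)
      then show ?thesis
        using inv2 T T' CX by simp
    qed
  qed
qed

text \<open>The three loops multiply the cost of a pass by \<open>7 * n\<close>,
  \<open>7 * k\<close> and \<open>7 * l\<close>, which gives \<open>7 * 7 * 7 * 23 = 7889\<close>.
  Finding \<open>iPos\<close>, computing the length and the last \<open>return\<close> add
  3.\<close>

lemma is_half_twist_time:
  assumes n: "n \<ge> 2" and k: "k \<ge> 1" and w: "w \<noteq> []"
    and braid: "braid_word n w" and pos: "positive_word n (drop (first_pos w - 1) w)"
  shows "real (time (is_half_twist S n w k))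
    \<le> 7892 * C * (real n ^ 2 * ln (real n) * real k ^ 2 * real (length w) ^ 3)"
proof -
  define l where "l = length w"
  define j where "j = first_pos w - 1"
  define X where "X = real n * ln (real n) * real k * real l ^ 2"
  have l1: "l \<ge> 1" using w by (simp add: l_def Suc_le_eq)
  have j: "first_pos w = j + 1" by (simp add: j_def first_pos_def)
  have "j \<le> l" by (simp add: j_def first_pos_def l_def length_takeWhile_le)
  have inv: "half_twist_inv n j l w"
    using braid pos by (simp add: half_twist_inv_def l_def j_def)
  define body where "body = (\<lambda>i. for_loop [0..<k + 1] (\<lambda>t. for_loop [j..<l + 1] (\<lambda>p.
    half_twist_step S n k (j + 1) l i t p)))"
  have "1 * 1 \<le> real n * ln (real n) * (real k * real l ^ 2)"
    using n_ln_n_ge_1[OF n] k l1 mult_mono[of 1 "real k" 1 "real l ^ 2"]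
    by (intro mult_mono) (auto simp: one_le_power)
  then have "1 \<le> X" by (simp add: X_def mult.assoc)
  have ge1: "1 \<le> a * b" if "1 \<le> a" "1 \<le> b" for a b :: real
    using mult_mono[of 1 a 1 b] that by simp
  have CX: "1 \<le> 23 * C * X" using C_ge_1 \<open>1 \<le> X\<close> by (intro ge1) auto
  have lCX: "1 \<le> 7 * real l * (23 * C * X)" using CX l1 by (intro ge1[of "7 * real l"]) auto
  have klCX: "1 \<le> 7 * real k * (7 * real l * (23 * C * X))" using lCX k by (intro ge1[of "7 * real k"]) auto
  have "half_twist_inv n j l (snd (val (for_loop [1..<n] body w))) \<and>
     real (time (for_loop [1..<n] body w))
       \<le> 7 * real n * (7 * real k * (7 * real l * (23 * C * X)))"
    unfolding body_def
    apply (intro for_loop_invariant_time_mult klCX lCX CX half_twist_step_bound[OF n k l1] X_def)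
    using n k l1 inv by auto
  then have loops: "real (time (for_loop [1..<n] body w)) \<le> 7889 * C * (real n * real k * real l * X)"
    by (simp add: mult_ac)
  have main: "real n * real k * real l * X
      = real n ^ 2 * ln (real n) * real k ^ 2 * real l ^ 3" (is "_ = ?M")
    by (simp add: X_def power2_eq_square power3_eq_cube)
  \<comment> \<open>The linear costs outside the loops are absorbed into the main term.\<close>
  have "real l * 1 \<le> real l * (real n * real k * X)"
    using ge1[of "real n * real k" X] ge1[of "real n" "real k"] n k \<open>1 \<le> X\<close>
    by (intro mult_left_mono) auto
  then have "real l \<le> ?M" unfolding main[symmetric] by (simp add: mult_ac)
  then have l_le: "C * real l \<le> C * ?M" using C_ge_1 by (intro mult_left_mono) auto
  have "1 \<le> C * real l" using ge1 C_ge_1 l1 by simp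
  moreover have "time (is_half_twist S n w k)
      = first_pos_cost S w + length_cost S w + time (for_loop [1..<n] body w) + 1"
    by (simp add: is_half_twist_def bind_timed_def first_pos_t_def length_t_def return_def
        case_prod_beta body_def j flip: l_def)
  ultimately have "real (time (is_half_twist S n w k)) \<le> 7892 * C * ?M"
    using loops length_time[OF l1, of w] first_pos_time[OF l1, of w] l_le
    unfolding main by (simp add: l_def)
  then show ?thesis by (simp add: l_def)
qed

end

section \<open>Normal forms and the final bound\<close>

text \<open>The power of the inverse of \<open>Delta n\<close> has only negative letters and
  \<open>w'\<close> only positive ones, so \<open>first_pos\<close> finds exactly the border between
  them. This provides the invariant at the start of the loops.\<close>

lemma normal_form_positive_part:
  assumes "normal_form n w"
  shows "positive_word n (drop (first_pos w - 1) w)"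
proof -
  obtain r w' where w: "w = Delta_inv_pow n r @ w'" and pos: "positive_word n w'"
    using assms by (auto simp: normal_form_def)
  have neg: "snd x \<noteq> 1" if "x \<in> set (Delta_inv_pow n r)" for x
    using that
    by (auto simp: Delta_inv_pow_def inv_word_def Delta_def sigma_def split: if_splits)
  have "takeWhile (\<lambda>x. snd x \<noteq> 1) w' = []"
    using pos by (cases w') (auto simp: positive_word_def)
  then have "takeWhile (\<lambda>x. snd x \<noteq> 1) w = Delta_inv_pow n r"
    using neg by (simp add: w takeWhile_append2)
  then show ?thesis
    using pos by (simp add: first_pos_def w)
qed

theorem proposition3p7:
  fixes S :: subroutines
  assumes "extract_left_correct (extract_left S)"
    and "extract_right_correct (extract_right S)"
    and "trivial_test_correct (trivial_test S)"
    and "extract_time_bound (extract_left S)"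
    and "extract_time_bound (extract_right S)"
    and "trivial_test_time_bound (trivial_test S)"
    and "manipulation_time_bounds S"
  shows "(\<lambda>(n :: nat, w :: word, k :: nat). real (time (is_half_twist S n w k)))
           \<in> O[principal {(n, w, k). n \<ge> 2 \<and> braid_word n w \<and> w \<noteq> [] \<and> normal_form n w \<and>
                                    int k = deg w \<and> k \<ge> 1}](
          \<lambda>(n, w, k). real n ^ 2 * ln (real n) * real k ^ 2 * real (length w) ^ 3)"
proof -
  \<comment> \<open>The constant depends on \<open>S\<close> alone, hence is uniform in
    \<open>n\<close>, \<open>w\<close> and \<open>k\<close>.\<close>
  obtain C where "bounded_subroutines S C"
    using bounded_subroutines_exists assms(1,2,4-7) by blast
  then interpret bounded_subroutines S C .
  show ?thesis
    by (intro bigoI[of _ "7892 * C"])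
      (auto simp: eventually_principal abs_mult
        dest: normal_form_positive_part intro!: is_half_twist_time)
qed

end
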